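(* Let $\Pi=\mathbb{R}/\mathbb{Z}$ be the circle, let $a\in C^2(\Pi)$ with $a>0$, and for a probability measure $\mu$ on $\Pi$ set $$I_1(\mu):=\sup_{u\in C^2(\Pi),\,u>0}\;-\int_\Pi a(x)\,\frac{u''(x)}{u(x)}\,d\mu(x).$$ Let $\mu$ be a probability measure on $\Pi$ and suppose there exists a non-empty open interval $I\subset\Pi$ with $\mu(I)=0$. Assume furthermore that there is a point $x_0\in\Pi$ such that, with $\alpha_l^-:=\dim^{-,l}_{\mathrm{loc}}(\mu,x_0)$ and $\alpha_r^+:=\dim^{+,r}_{\mathrm{loc}}(\mu,x_0)$, one of the following conditions holds: (1) $-\infty<\alpha_l^-<\alpha_r^+$ and $\alpha_l^-<1$; (2) $-\infty<\alpha_l^-=\alpha_r^+<1$; (3) $-\infty=\alpha_l^-<\alpha_r^+\le1$. Then $I_1(\mu)=+\infty$.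
   Context: For a probability measure $\mu$ on $\Pi$ and $x_0\in\Pi$, the left lower and right upper local dimensions are $$\dim^{-,l}_{\mathrm{loc}}(\mu,x_0)=\liminf_{r\to0}\frac{\log\mu([x_0-r,x_0])}{\log r},\qquad \dim^{+,r}_{\mathrm{loc}}(\mu,x_0)=\limsup_{r\to0}\frac{\log\mu([x_0,x_0+r])}{\log r}.$$ By convention, if the measure $\mu(\cdot)$ in the numerator is equal to $0$ for all sufficiently small $r$, the corresponding local dimension is defined to be $-\infty$. *)

theory Defs
  imports "HOL-Probability.Probability"
begin

definition int_cong :: "real \<Rightarrow> real \<Rightarrow> bool" where
  "int_cong s t \<longleftrightarrow> s - t \<in> \<int>"

quotient_type circle = real / int_cong
  morphisms rep_circle to_circle
proof (rule equivpI)
  show "reflp int_cong"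
    by (simp add: reflp_def int_cong_def)
  show "symp int_cong"
    unfolding symp_def int_cong_def by (metis Ints_minus minus_diff_eq)
  show "transp int_cong"
    unfolding transp_def int_cong_def by (metis Ints_add diff_add_cancel add_diff_eq)
qed

instantiation circle :: ab_group_add
begin

lift_definition zero_circle :: circle is "0 :: real" .

lift_definition plus_circle :: "circle \<Rightarrow> circle \<Rightarrow> circle" is "(+) :: real \<Rightarrow> real \<Rightarrow> real"
  unfolding int_cong_def by (metis Ints_add add_diff_add)

lift_definition uminus_circle :: "circle \<Rightarrow> circle" is "uminus :: real \<Rightarrow> real"
  unfolding int_cong_def by (metis Ints_minus minus_diff_minus)

lift_definition minus_circle :: "circle \<Rightarrow> circle \<Rightarrow> circle" is "(-) :: real \<Rightarrow> real \<Rightarrow> real"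
  unfolding int_cong_def by (metis Ints_diff diff_diff_add diff_diff_eq2 add_diff_eq add.commute)

instance
  by standard (transfer, simp add: int_cong_def)+

end

text \<open>The quotient topology; the Borel sets of the circle are those of this topology.\<close>

instantiation circle :: topological_space
begin

definition open_circle :: "circle set \<Rightarrow> bool" where
  "open_circle U \<longleftrightarrow> open (to_circle -` U)"

instance
  by standard (auto simp: open_circle_def vimage_Union)

end

definition circle_differentiable_at :: "(circle \<Rightarrow> real) \<Rightarrow> circle \<Rightarrow> bool" where
  "circle_differentiable_at u x \<longleftrightarrow> (\<lambda>t. u (x + to_circle t)) differentiable (at 0)"

definition circle_deriv :: "(circle \<Rightarrow> real) \<Rightarrow> circle \<Rightarrow> real" where
  "circle_deriv u x = deriv (\<lambda>t. u (x + to_circle t)) 0"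

definition C2_circle :: "(circle \<Rightarrow> real) set" where
  "C2_circle = {u. (\<forall>x. circle_differentiable_at u x) \<and>
                   (\<forall>x. circle_differentiable_at (circle_deriv u) x) \<and>
                   continuous_on UNIV (circle_deriv (circle_deriv u))}"

text \<open>For \<open>u\<close> in the index set the integrand is continuous on a compact space, so for a finite
  Borel measure the Bochner integral is never the default value of a non-integrable function.\<close>

definition I1 :: "(circle \<Rightarrow> real) \<Rightarrow> circle measure \<Rightarrow> ereal" where
  "I1 a \<mu> = (SUP u \<in> {u \<in> C2_circle. \<forall>x. u x > 0}.
      ereal (- (\<integral>x. a x * (circle_deriv (circle_deriv u) x / u x) \<partial>\<mu>)))"

text \<open>The bound \<open>t \<le> s + 1\<close> makes the parametrisation of the interval injective.\<close>

definition nonempty_open_interval :: "circle set \<Rightarrow> bool" where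
  "nonempty_open_interval I \<longleftrightarrow> (\<exists>s t. s < t \<and> t \<le> s + 1 \<and> I = to_circle ` {s<..<t})"

definition left_interval :: "circle \<Rightarrow> real \<Rightarrow> circle set" where
  "left_interval x r = (\<lambda>t. x - to_circle t) ` {0..r}"

definition right_interval :: "circle \<Rightarrow> real \<Rightarrow> circle set" where
  "right_interval x r = (\<lambda>t. x + to_circle t) ` {0..r}"

text \<open>As these measures are monotone in \<open>r\<close>, outside the \<open>- \<infinity>\<close> case they are positive for every
  \<open>r > 0\<close>, so the totalised value of \<open>ln 0\<close> plays no role.\<close>

definition lower_left_local_dim :: "circle measure \<Rightarrow> circle \<Rightarrow> ereal" where
  "lower_left_local_dim \<mu> x =
     (if \<forall>\<^sub>F r in at_right 0. measure \<mu> (left_interval x r) = 0 then - \<infinity>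
      else Liminf (at_right 0) (\<lambda>r. ereal (ln (measure \<mu> (left_interval x r)) / ln r)))"

definition upper_right_local_dim :: "circle measure \<Rightarrow> circle \<Rightarrow> ereal" where
  "upper_right_local_dim \<mu> x =
     (if \<forall>\<^sub>F r in at_right 0. measure \<mu> (right_interval x r) = 0 then - \<infinity>
      else Limsup (at_right 0) (\<lambda>r. ereal (ln (measure \<mu> (right_interval x r)) / ln r)))"

end

theory Submission
  imports Defs
begin

text \<open>If \<open>I1 a \<mu>\<close> is finite, single test functions bound the mass of small intervals.
  The smoothed tent \<open>3 - sqrt (e\<^sup>2 + sin\<^sup>2 \<pi>(t - p))\<close>, \<open>e = \<pi> r\<close>, has
  second derivative of order \<open>- 1 / r\<close> within distance \<open>r\<close> of \<open>p\<close> and bounded above elsewhere, so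
  \<open>\<mu> [p - r, p] \<le> M r\<close>; hence the lower left dimension is at least 1 unless it is \<open>- \<infinity>\<close>.
  If \<open>\<mu>\<close> vanishes just left of \<open>p\<close>, the well
  \<open>1 - e\<^sup>2 / (2 (e\<^sup>2 + sin\<^sup>2 \<pi>(t - p + r)))\<close>, \<open>e = sin (\<pi> r)\<close>, is convex only inside
  \<open>[p - 2 r, p]\<close>, where there is no mass, and has second derivative of order \<open>- 1 / r\<^sup>2\<close> on
  \<open>[p, p + r]\<close>. So \<open>\<mu> [p, p + r] \<le> M r\<^sup>2\<close>, and the upper right dimension is
  at least 2 unless it is \<open>- \<infinity>\<close>.\<close>

section \<open>Lifts to the line, arcs and the quotient topology\<close>

lemma to_circle_eq_iff: "to_circle s = to_circle t \<longleftrightarrow> s - t \<in> \<int>"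
  using circle.abs_eq_iff int_cong_def by simp

lemma to_circle_add: "to_circle s + to_circle t = to_circle (s + t)"
  by (simp add: plus_circle.abs_eq)

lemma to_circle_diff: "to_circle s - to_circle t = to_circle (s - t)"
  by (simp add: minus_circle.abs_eq)

lemma to_circle_rep: "to_circle (rep_circle x) = x"
  by (rule Quotient3_abs_rep[OF Quotient3_circle])

text \<open>A shifted fractional part lies in [p, p + 1); the free base point \<open>p\<close> lets
  each argument cut the circle where it suits.\<close>

lemma to_circle_representative:
  obtains t where "x = to_circle t" "p \<le> t" "t < p + 1"
proof
  let ?t = "p + frac (rep_circle x - p)"
  have "rep_circle x - ?t = of_int \<lfloor>rep_circle x - p\<rfloor>"
    by (simp add: frac_def)
  then have "to_circle (rep_circle x) = to_circle ?t"
    unfolding to_circle_eq_iff by (metis Ints_of_int)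
  then show "x = to_circle ?t" by (simp add: to_circle_rep)
  show "p \<le> ?t" "?t < p + 1" by (auto simp: frac_lt_1)
qed

lemma left_interval_to_circle: "left_interval (to_circle p) r = to_circle ` {p - r..p}"
proof -
  have "{p - r..p} = (\<lambda>t. p - t) ` {0..r}"
    by (simp add: image_diff_atLeastAtMost)
  then show ?thesis
    unfolding left_interval_def by (simp only: to_circle_diff image_image)
qed

lemma right_interval_to_circle: "right_interval (to_circle p) r = to_circle ` {p..p + r}"
proof -
  have "{p..p + r} = (\<lambda>t. p + t) ` {0..r}"
    by (simp add: image_add_atLeastAtMost)
  then show ?thesis
    unfolding right_interval_def by (simp only: to_circle_add image_image)
qed

text \<open>The preimage of the image is the union of all integer translates of \<open>S\<close>,
  hence open in the line.\<close>

lemma open_to_circle_image: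
  assumes "open S"
  shows "open (to_circle ` S)"
proof -
  have "to_circle -` to_circle ` S = (\<Union>n. (\<lambda>t. of_int n + t) ` S)" (is "?L = ?R")
  proof (intro set_eqI iffI)
    fix t assume "t \<in> ?L"
    then obtain s where "s \<in> S" "t - s \<in> \<int>"
      using to_circle_eq_iff by auto
    moreover from this obtain n where "t = of_int n + s"
      by (metis Ints_cases add_diff_cancel_left' diff_add_cancel)
    ultimately show "t \<in> ?R" by auto
  next
    fix t assume "t \<in> ?R"
    then obtain n s where "s \<in> S" "t = of_int n + s" by auto
    moreover from this have "to_circle t = to_circle s"
      unfolding to_circle_eq_iff by simp
    ultimately show "t \<in> ?L" by auto
  qed
  moreover have "open ((\<lambda>t. of_int n + t) ` S)" for n
    using open_translation[OF assms] by simp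
  ultimately show ?thesis
    unfolding open_circle_def by auto
qed

text \<open>For \<open>0 \<le> r < 1\<close> the complement is an open arc; a negative
  \<open>r\<close> gives the empty set and \<open>r \<ge> 1\<close> the whole circle. Closedness
  makes the interval a Borel set.\<close>

lemma closed_left_interval: "closed (left_interval x r)"
proof -
  obtain p where p: "x = to_circle p" by (metis to_circle_rep)
  consider "r < 0" | "0 \<le> r" "r < 1" | "1 \<le> r" by linarith
  then show ?thesis
  proof cases
    case 1
    then show ?thesis by (simp add: left_interval_def)
  next
    case 2
    have "- left_interval x r = to_circle ` {p<..<p + 1 - r}"
    proof (intro set_eqI iffI)
      fix y assume y: "y \<in> - left_interval x r"
      obtain t where t: "y = to_circle t" "p \<le> t" "t < p + 1"
        by (rule to_circle_representative)
      have "to_circle (t - 1) = y" using t by (simp add: to_circle_eq_iff)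
      \<comment> \<open>Both \<open>t\<close> and \<open>t - 1\<close> are lifts of
        \<open>y\<close>: excluding the first rules out \<open>t = p\<close>, excluding the second
        rules out \<open>t \<ge> p + 1 - r\<close>.\<close>
      then have "t \<notin> {p - r..p}" "t - 1 \<notin> {p - r..p}"
        using y t(1) unfolding p left_interval_to_circle by (metis Compl_iff imageI)+
      then have "t \<in> {p<..<p + 1 - r}" using t 2 by auto
      then show "y \<in> to_circle ` {p<..<p + 1 - r}" using t by auto
    next
      fix y assume "y \<in> to_circle ` {p<..<p + 1 - r}"
      then obtain t where t: "y = to_circle t" "p < t" "t < p + 1 - r" by auto
      show "y \<in> - left_interval x r"
      proof
        assume "y \<in> left_interval x r"
        then obtain s where s: "y = to_circle s" "p - r \<le> s" "s \<le> p"
          by (auto simp: p left_interval_to_circle)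
        then have "t - s \<in> \<int>" using t to_circle_eq_iff by simp
        then obtain n where n: "t - s = of_int n" by (rule Ints_cases)
        \<comment> \<open>Here \<open>s \<le> p < t\<close> and
          \<open>t < p + 1 - r \<le> s + 1\<close>.\<close>
        have "0 < real_of_int n" "real_of_int n < 1" using n s t by linarith+
        then show False by auto
      qed
    qed
    then show ?thesis
      unfolding closed_def using open_to_circle_image[of "{p<..<p + 1 - r}"] by simp
  next
    case 3
    have "y \<in> left_interval x r" for y
    proof -
      obtain t where "y = to_circle t" "p - 1 \<le> t" "t < p - 1 + 1"
        by (rule to_circle_representative)
      then show ?thesis using 3 by (auto simp: p left_interval_to_circle)
    qed
    then have "left_interval x r = UNIV" by blast
    then show ?thesis by simp
  qed
qed

lemma closed_right_interval: "closed (right_interval x r)"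
proof -
  obtain p where "x = to_circle p" by (metis to_circle_rep)
  then have "right_interval x r = left_interval (to_circle (p + r)) r"
    by (simp add: left_interval_to_circle right_interval_to_circle)
  then show ?thesis by (simp add: closed_left_interval)
qed

section \<open>Functions on the circle and their periodic lifts\<close>

lemma continuous_on_circle:
  assumes "continuous_on UNIV (\<lambda>t. u (to_circle t))"
  shows "continuous_on UNIV u"
proof -
  have "open (u -` B)" if "open B" for B
  proof -
    have "open ((\<lambda>t. u (to_circle t)) -` B)"
      using continuous_open_vimage[of B "\<lambda>t. u (to_circle t)"] assms that
      by (simp add: continuous_on_eq_continuous_at)
    then show ?thesis
      by (simp add: open_circle_def vimage_def)
  qed
  then show ?thesis
    by (simp add: continuous_on_open_vimage)
qed

text \<open>Translation by \<open>to_circle s\<close> on the circle is translation of the lift by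
  \<open>s\<close>, so circle derivatives are ordinary derivatives of the lift.\<close>

lemma circle_deriv_to_circle:
  assumes "\<And>t. u (to_circle t) = f t" and "\<And>t. (f has_real_derivative f' t) (at t)"
  shows "circle_differentiable_at u x" and "circle_deriv u (to_circle t) = f' t"
proof -
  have *: "((\<lambda>s. u (to_circle t + to_circle s)) has_real_derivative f' t) (at 0)" for t
  proof -
    have "((\<lambda>s. f (s + t)) has_real_derivative f' t) (at 0)"
      using assms(2)[of t] DERIV_shift[of f "f' t" 0 t] by simp
    then show ?thesis by (simp add: to_circle_add assms(1) add.commute)
  qed
  obtain s where "x = to_circle s" by (metis to_circle_rep)
  then show "circle_differentiable_at u x"
    unfolding circle_differentiable_at_def
    using *[of s] real_differentiable_def by blast
  show "circle_deriv u (to_circle t) = f' t"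
    unfolding circle_deriv_def using *[of t] by (rule DERIV_imp_deriv)
qed

text \<open>This builds the test functions: all calculus is done with a 1-periodic function on the
  line.\<close>

lemma C2_circle_lift:
  fixes f :: "real \<Rightarrow> real"
  assumes per: "\<And>s t. s - t \<in> \<int> \<Longrightarrow> f s = f t"
    and f': "\<And>t. (f has_real_derivative f' t) (at t)"
    and f'': "\<And>t. (f' has_real_derivative f'' t) (at t)"
    and cont: "continuous_on UNIV f''"
  obtains u where "u \<in> C2_circle" and "\<And>t. u (to_circle t) = f t"
    and "\<And>t. circle_deriv (circle_deriv u) (to_circle t) = f'' t"
proof
  define u where "u x = f (rep_circle x)" for x
  show u: "u (to_circle t) = f t" for t
    unfolding u_def using to_circle_rep[of "to_circle t"] to_circle_eq_iff by (auto intro: per)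
  note d1 = circle_deriv_to_circle[of u f, OF u f']
  note d2 = circle_deriv_to_circle[of "circle_deriv u" f', OF d1(2) f'']
  show "circle_deriv (circle_deriv u) (to_circle t) = f'' t" for t
    by (rule d2)
  then show "u \<in> C2_circle"
    unfolding C2_circle_def using d1(1) d2(1) cont by (auto intro: continuous_on_circle)
qed

lemma C2_circle_imp_continuous:
  assumes "u \<in> C2_circle"
  shows "continuous_on UNIV (\<lambda>t. u (to_circle t))"
proof -
  have "isCont (\<lambda>t. u (to_circle t)) t" for t
  proof -
    have "(\<lambda>s. u (to_circle t + to_circle s)) differentiable at 0"
      using assms unfolding C2_circle_def circle_differentiable_at_def by blast
    then have "isCont (\<lambda>s. u (to_circle (t + s))) 0"
      unfolding to_circle_add by (rule differentiable_imp_continuous_within)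
    then have "isCont (\<lambda>s. u (to_circle s)) (t + 0)"
      unfolding isCont_def using LIM_isCont_iff[of "\<lambda>s. u (to_circle s)" t] by simp
    then show ?thesis by simp
  qed
  then show ?thesis by (simp add: continuous_on_eq_continuous_at)
qed

text \<open>The circle is the image of the compact interval [0, 1]. This yields bounds on
  \<open>a\<close> and boundedness of the integrands.\<close>

lemma circle_continuous_range:
  assumes "continuous_on UNIV (\<lambda>t. u (to_circle t))"
  obtains y z where "\<And>x. u y \<le> (u x :: real)" and "\<And>x. u x \<le> u z"
proof -
  have c: "continuous_on {0..1::real} (\<lambda>t. u (to_circle t))"
    using assms continuous_on_subset by blast
  obtain s where s: "\<And>t. t \<in> {0..1} \<Longrightarrow> u (to_circle s) \<le> u (to_circle t)"
    using continuous_attains_inf[OF _ _ c] by fastforce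
  obtain s' where s': "\<And>t. t \<in> {0..1} \<Longrightarrow> u (to_circle t) \<le> u (to_circle s')"
    using continuous_attains_sup[OF _ _ c] by fastforce
  have "\<exists>t\<in>{0..1}. x = to_circle t" for x
    by (rule to_circle_representative[of x 0]) auto
  with s s' show thesis by (metis that)
qed

lemma C2_circle_ratio_continuous:
  assumes "a \<in> C2_circle" "u \<in> C2_circle" "\<And>x. u x > 0"
  shows "continuous_on UNIV (\<lambda>t. a (to_circle t) *
    (circle_deriv (circle_deriv u) (to_circle t) / u (to_circle t)))"
proof -
  have "continuous_on UNIV to_circle"
    by (simp add: continuous_on_open_vimage open_circle_def)
  moreover have "continuous_on UNIV (circle_deriv (circle_deriv u))"
    using assms(2) by (simp add: C2_circle_def)
  ultimately have "continuous_on UNIV (\<lambda>t. circle_deriv (circle_deriv u) (to_circle t))"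
    using continuous_on_compose2 by blast
  moreover have "u (to_circle t) \<noteq> 0" for t
    using assms(3) less_irrefl by metis
  ultimately show ?thesis
    using assms(1,2) by (intro continuous_on_mult continuous_on_divide)
      (simp_all add: C2_circle_imp_continuous)
qed

section \<open>Lower bounds for \<open>I1\<close> from a single test function\<close>

text \<open>Pointwise, \<open>c\<close> times an indicator minus \<open>K\<close> lies below the
  integrand of \<open>u\<close>; then integrate. The bound \<open>- K\<close> is asked only almost
  everywhere, so that \<open>u\<close> may be convex on a null arc.\<close>

lemma I1_lower_bound:
  assumes a: "a \<in> C2_circle" and \<mu>: "prob_space \<mu>" "sets \<mu> = sets borel"
    and u: "u \<in> C2_circle" "\<And>x. u x > 0"
    and AE: "AE x in \<mu>. - K \<le> - (a x * (circle_deriv (circle_deriv u) x / u x))"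
    and L: "\<And>x. x \<in> L \<Longrightarrow> c \<le> - (a x * (circle_deriv (circle_deriv u) x / u x))"
    and K: "0 \<le> K" and "0 \<le> c"
  shows "ereal (c * measure \<mu> L - K) \<le> I1 a \<mu>"
proof -
  interpret prob_space \<mu> by fact
  define h where "h x = a x * (circle_deriv (circle_deriv u) x / u x)" for x
  have cont: "continuous_on UNIV (\<lambda>t. h (to_circle t))"
    unfolding h_def by (rule C2_circle_ratio_continuous[OF a u])
  have meas: "h \<in> borel_measurable \<mu>"
    using borel_measurable_continuous_onI[OF continuous_on_circle[OF cont]] \<mu>(2)
    by (simp cong: measurable_cong_sets)
  obtain y z where "\<And>x. h y \<le> h x" "\<And>x. h x \<le> h z"
    using circle_continuous_range[OF cont] by blast
  then have "\<And>x. \<bar>h x\<bar> \<le> \<bar>h y\<bar> + \<bar>h z\<bar>" by (smt (verit))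
  then have int: "integrable \<mu> h"
    by (intro integrable_const_bound[OF _ meas]) auto
  \<comment> \<open>\<open>B\<close> is a measurable superset of \<open>L\<close> on which the bound
    \<open>c\<close> still holds, so its indicator can be integrated.\<close>
  define B where "B = {x \<in> space \<mu>. c \<le> - h x}"
  have B: "B \<in> sets \<mu>" unfolding B_def using meas by measurable
  have "space \<mu> = UNIV" using \<mu>(2) sets_eq_imp_space_eq by fastforce
  then have "L \<subseteq> B" using L by (auto simp: B_def h_def)
  then have "measure \<mu> L \<le> measure \<mu> B"
    using B by (rule finite_measure_mono)
  then have "c * measure \<mu> L - K \<le> c * measure \<mu> B - K"
    using \<open>0 \<le> c\<close> by (simp add: mult_left_mono)
  also have "\<dots> = (\<integral>x. c * indicator B x - K \<partial>\<mu>)"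
    using B by (simp add: emeasure_eq_measure prob_space)
  also have "\<dots> \<le> (\<integral>x. - h x \<partial>\<mu>)"
  proof (rule integral_mono_AE)
    \<comment> \<open>On \<open>B\<close> this uses \<open>K \<ge> 0\<close>; off \<open>B\<close>
      it is the almost-everywhere bound.\<close>
    show "AE x in \<mu>. c * indicator B x - K \<le> - h x"
      using AE by (rule AE_mp) (use K in \<open>auto simp: B_def h_def indicator_def intro!: AE_I2\<close>)
  qed (use B int in \<open>auto simp: emeasure_eq_measure\<close>)
  also have "\<dots> = - (\<integral>x. h x \<partial>\<mu>)" by simp
  finally have "ereal (c * measure \<mu> L - K) \<le> ereal (- (\<integral>x. h x \<partial>\<mu>))" by simp
  also have "\<dots> \<le> I1 a \<mu>"
    unfolding I1_def h_def using u by (intro SUP_upper) auto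
  finally show ?thesis .
qed

text \<open>A shift by n multiplies the sine by (-1)^n, so its square descends to the
  circle.\<close>

lemma sin_pi_square_periodic:
  assumes "s - t \<in> \<int>"
  shows "(sin (pi * (s - p)))\<^sup>2 = (sin (pi * (t - p)))\<^sup>2"
proof -
  obtain n where "s - t = of_int n" using assms by (rule Ints_cases)
  then have "s = t + of_int n" by simp
  then have s: "pi * (s - p) = pi * (t - p) + pi * of_int n"
    by (simp add: algebra_simps)
  have "(cos (pi * of_int n))\<^sup>2 = 1" "sin (pi * of_int n) = 0"
    using sin_cos_squared_add[of "pi * of_int n"] by (auto simp: sin_int_times_real mult.commute)
  then show ?thesis by (simp add: s sin_add power_mult_distrib)
qed

section \<open>Mass to the left: the smoothed tent\<close>

text \<open>The tent \<open>u\<close> takes values in [1, 3], and -u'' is at least 1/(16 r) on the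
  interval and at least -16 everywhere. Dividing by \<open>u\<close> gives the constants 48 = 3 * 16
  and 16.\<close>

lemma left_interval_bound:
  assumes a: "a \<in> C2_circle" "\<And>x. m \<le> a x" "\<And>x. a x \<le> A" "0 < m"
    and \<mu>: "prob_space \<mu>" "sets \<mu> = sets borel"
    and r: "0 < r" "r \<le> 1/10"
  shows "ereal (m / (48 * r) * measure \<mu> (left_interval x0 r) - 16 * A) \<le> I1 a \<mu>"
proof -
  obtain p where p: "x0 = to_circle p" by (metis to_circle_rep)
  define e where "e = pi * r"
  \<comment> \<open>The resulting \<open>e \<le> 2/5\<close> is what later gives e^2 \<le>
    1/6.\<close>
  have "pi * r \<le> 4 * (1/10)" using r pi_less_4 by (intro mult_mono) auto
  then have e: "0 < e" "e \<le> 2/5" using r by (auto simp: e_def)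
  define S where "S t = sin (pi * (t - p))" for t
  define C where "C t = cos (pi * (t - p))" for t
  define w where "w t = sqrt (e\<^sup>2 + (S t)\<^sup>2)" for t
  have C2: "(C t)\<^sup>2 = 1 - (S t)\<^sup>2" for t by (simp add: C_def S_def cos_squared_eq)
  have S2: "(S t)\<^sup>2 \<le> 1" for t unfolding S_def by (rule abs_square_le_1[THEN iffD2]) simp
  have wpos: "0 < w t" for t unfolding w_def using e by (simp add: add_pos_nonneg)
  have w2: "(w t)\<^sup>2 = e\<^sup>2 + (S t)\<^sup>2" for t unfolding w_def by simp
  define f1 where "f1 t = - pi * (S t * C t / w t)" for t
  define f2 where "f2 t = - pi\<^sup>2 * (((C t)\<^sup>2 - (S t)\<^sup>2) * (w t)\<^sup>2 - (S t)\<^sup>2 * (C t)\<^sup>2) / (w t) ^ 3" for t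
  have dS: "(S has_real_derivative pi * C t) (at t)" for t
    unfolding S_def C_def by (auto intro!: derivative_eq_intros)
  have dC: "(C has_real_derivative - pi * S t) (at t)" for t
    unfolding S_def C_def by (auto intro!: derivative_eq_intros)
  have dw: "(w has_real_derivative pi * (S t * C t / w t)) (at t)" for t
    unfolding w_def using wpos[of t] e
    by (auto intro!: derivative_eq_intros dS simp: w_def field_simps)
  have d1: "((\<lambda>t. 3 - w t) has_real_derivative f1 t) (at t)" for t
    unfolding f1_def by (auto intro!: derivative_eq_intros dw)
  have d2: "(f1 has_real_derivative f2 t) (at t)" for t
    unfolding f1_def f2_def using wpos[of t]
    by (auto intro!: derivative_eq_intros dw dS dC)
       (simp add: field_simps power2_eq_square power3_eq_cube)
  have "continuous_on UNIV f2"
    unfolding f2_def using wpos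
    by (intro continuous_intros DERIV_continuous_on[OF dS] DERIV_continuous_on[OF dC]
        DERIV_continuous_on[OF dw]) (auto simp: less_le)
  moreover have "3 - w s = 3 - w t" if "s - t \<in> \<int>" for s t
    using sin_pi_square_periodic[OF that, of p] by (simp add: w_def S_def)
  ultimately obtain u where u: "u \<in> C2_circle" "\<And>t. u (to_circle t) = 3 - w t"
    "\<And>t. circle_deriv (circle_deriv u) (to_circle t) = f2 t"
    using C2_circle_lift[of "\<lambda>t. 3 - w t" f1 f2] d1 d2 by metis
  have w_le: "w t \<le> 2" for t
    unfolding w_def using S2[of t] power_mono[OF e(2), of 2] e
    by (intro real_le_lsqrt) (auto simp: power2_eq_square)
  \<comment> \<open>The numerator splits into a nonnegative part, dominant near \<open>p\<close>,
    minus S^2 w^2.\<close>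
  have f2_eq: "- f2 t = pi\<^sup>2 * (e\<^sup>2 * (1 - (S t)\<^sup>2) - (S t)\<^sup>2 * (w t)\<^sup>2) / (w t) ^ 3" for t
    unfolding f2_def w2 C2 minus_mult_left[symmetric] minus_divide_left[symmetric] minus_minus
    by (simp add: algebra_simps)
  \<comment> \<open>Since S^2 \<le> |S| \<le> w, the subtracted part is at most w^3 whatever
    \<open>e\<close> is; then pi^2 \<le> 16.\<close>
  have low: "- 16 \<le> - f2 t" for t
  proof -
    have "(S t)\<^sup>2 = abs (S t) * abs (S t)" by (simp add: power2_eq_square flip: abs_mult)
    also have "\<dots> \<le> 1 * abs (S t)"
      using S2[of t] by (intro mult_right_mono) (auto simp: abs_square_le_1)
    also have "\<dots> \<le> w t" unfolding w_def by (simp add: real_le_rsqrt)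
    finally have "(S t)\<^sup>2 * (w t)\<^sup>2 \<le> w t * (w t)\<^sup>2" by (rule mult_right_mono) simp
    then have "(S t)\<^sup>2 * (w t)\<^sup>2 \<le> (w t) ^ 3"
      by (simp add: power2_eq_square power3_eq_cube)
    moreover have "0 \<le> e\<^sup>2 * (1 - (S t)\<^sup>2)" using S2[of t] by simp
    ultimately have "- ((w t) ^ 3) \<le> e\<^sup>2 * (1 - (S t)\<^sup>2) - (S t)\<^sup>2 * (w t)\<^sup>2" by linarith
    then have "pi\<^sup>2 * (- ((w t) ^ 3)) / (w t) ^ 3 \<le> - f2 t"
      unfolding f2_eq using wpos[of t] by (intro divide_right_mono mult_left_mono) auto
    moreover have "pi\<^sup>2 * (- ((w t) ^ 3)) / (w t) ^ 3 = - pi\<^sup>2"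
      using wpos[of t] by simp
    moreover have "pi\<^sup>2 \<le> 4\<^sup>2" using pi_less_4 by (intro power_mono) auto
    ultimately show ?thesis by simp
  qed
  \<comment> \<open>Near \<open>p\<close>, |S| \<le> e gives w \<le> 2 e. As e^2 \<le> 1/6, the
    numerator loses at most e^2/6 and e^2/3 and keeps e^2/2, so the quotient has order 1/e.\<close>
  have high: "1 / (16 * r) \<le> - f2 t" if "p - r \<le> t" "t \<le> p" for t
  proof -
    have "\<bar>S t\<bar> \<le> pi * \<bar>t - p\<bar>"
      unfolding S_def using abs_sin_x_le_abs_x[of "pi * (t - p)"] by (simp add: abs_mult)
    also have "\<dots> \<le> e" using that by (simp add: e_def)
    finally have "\<bar>S t\<bar> \<le> e" .
    then have Se: "(S t)\<^sup>2 \<le> e\<^sup>2" using power_mono[of "\<bar>S t\<bar>" e 2] by simp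
    have e2: "e\<^sup>2 \<le> 1/6" using power_mono[OF e(2), of 2] e by (simp add: power2_eq_square)
    have "w t \<le> 2 * e"
      unfolding w_def
    proof (rule real_le_lsqrt)
      show "e\<^sup>2 + (S t)\<^sup>2 \<le> (2 * e)\<^sup>2"
        using Se by (simp add: power_mult_distrib add_mono order_trans[of _ "e\<^sup>2"])
    qed (use e in auto)
    then have w3: "(w t) ^ 3 \<le> 8 * e ^ 3"
      using power_mono[of "w t" "2 * e" 3] wpos[of t] by (simp add: power_mult_distrib)
    have "e\<^sup>2 * (S t)\<^sup>2 \<le> e\<^sup>2 * (1/6)" using Se e2 by (intro mult_left_mono) auto
    moreover have "(S t)\<^sup>2 * (w t)\<^sup>2 \<le> (1/6) * (2 * e\<^sup>2)"
      using Se e2 unfolding w2 by (intro mult_mono) auto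
    ultimately have *: "e\<^sup>2 / 2 \<le> e\<^sup>2 * (1 - (S t)\<^sup>2) - (S t)\<^sup>2 * (w t)\<^sup>2"
      by (simp add: algebra_simps)
    have "0 \<le> e\<^sup>2 * (1 - (S t)\<^sup>2) - (S t)\<^sup>2 * (w t)\<^sup>2"
      by (rule order_trans[OF _ *]) simp
    with * have "pi\<^sup>2 * (e\<^sup>2 / 2) / (8 * e ^ 3) \<le> - f2 t"
      unfolding f2_eq using w3 wpos[of t] by (intro frac_le mult_left_mono mult_nonneg_nonneg) simp_all
    moreover have "pi\<^sup>2 * (e\<^sup>2 / 2) / (8 * e ^ 3) = pi / (16 * r)"
      using r by (simp add: e_def field_simps power2_eq_square power3_eq_cube)
    moreover have "1 / (16 * r) \<le> pi / (16 * r)"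
      using r pi_gt3 by (intro divide_right_mono) auto
    ultimately show ?thesis by simp
  qed
  have upos: "1 \<le> u x" and ule: "u x \<le> 3" for x
    using to_circle_rep[of x] u(2)[of "rep_circle x"] w_le[of "rep_circle x"] wpos[of "rep_circle x"]
    by auto
  have "0 \<le> A" using a(2,3)[of x0] a(4) by linarith
  show ?thesis
  proof (rule I1_lower_bound[OF a(1) \<mu> u(1)])
    fix x show "0 < u x" using upos[of x] by simp
  next
    have "- (16 * A) \<le> - (a x * (circle_deriv (circle_deriv u) x / u x))" for x
    proof -
      obtain t where t: "x = to_circle t" by (metis to_circle_rep)
      have "f2 t / u x \<le> 16"
        using low[of t] upos[of x] by (simp add: divide_le_eq)
      then have "a x * (f2 t / u x) \<le> a x * 16"
        using a(2)[of x] a(4) by (intro mult_left_mono) auto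
      also have "\<dots> \<le> 16 * A" using a(3)[of x] by simp
      finally show ?thesis using u(3) t by simp
    qed
    then show "AE x in \<mu>. - (16 * A) \<le> - (a x * (circle_deriv (circle_deriv u) x / u x))"
      by simp
  next
    fix x assume "x \<in> left_interval x0 r"
    then obtain t where t: "x = to_circle t" "p - r \<le> t" "t \<le> p"
      by (auto simp: p left_interval_to_circle)
    have "0 \<le> 1 / (16 * r)" using r by simp
    then have "f2 t \<le> 0" using high[OF t(2,3)] by linarith
    have "m / (48 * r) = m * (1 / (16 * r) / 3)" by simp
    also have "\<dots> \<le> a x * (- f2 t / u x)"
      using high[OF t(2,3)] \<open>f2 t \<le> 0\<close> a(2)[of x] a(4) upos[of x] ule[of x] r
      by (intro mult_mono frac_le) auto
    finally show "m / (48 * r) \<le> - (a x * (circle_deriv (circle_deriv u) x / u x))"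
      using u(3) t by simp
  qed (use a \<open>0 \<le> A\<close> r in auto)
qed

section \<open>Mass to the right of a null arc: the well\<close>

lemma right_interval_bound:
  assumes a: "a \<in> C2_circle" "\<And>x. m \<le> a x" "0 < m"
    and \<mu>: "prob_space \<mu>" "sets \<mu> = sets borel"
    and r0: "measure \<mu> (left_interval x0 r0) = 0"
    and r: "0 < r" "r \<le> 1/4" "2 * r \<le> r0"
  shows "ereal (m / (125 * r\<^sup>2) * measure \<mu> (right_interval x0 r)) \<le> I1 a \<mu>"
proof -
  interpret prob_space \<mu> by fact
  obtain p where p: "x0 = to_circle p" by (metis to_circle_rep)
  \<comment> \<open>\<open>q\<close> is the centre of [p - 2 r, p], which lies in the null left
    interval because \<open>2 * r \<le> r0\<close>. At both ends of that arc S^2 equals e^2.\<close>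
  define q where "q = p - r"
  define e where "e = sin (pi * r)"
  have "0 < e" unfolding e_def using r by (intro sin_gt_zero) (auto simp: field_simps)
  have e_le: "e \<le> pi * r" unfolding e_def using r by (intro sin_x_le_x) auto
  define S where "S t = sin (pi * (t - q))" for t
  define C where "C t = cos (pi * (t - q))" for t
  define W where "W t = e\<^sup>2 + (S t)\<^sup>2" for t
  have C2: "(C t)\<^sup>2 = 1 - (S t)\<^sup>2" for t by (simp add: C_def S_def cos_squared_eq)
  have S2: "(S t)\<^sup>2 \<le> 1" for t unfolding S_def by (rule abs_square_le_1[THEN iffD2]) simp
  have Wpos: "0 < W t" for t unfolding W_def using \<open>0 < e\<close> by (simp add: add_pos_nonneg)
  define f where "f t = 1 - e\<^sup>2 / (2 * W t)" for t
  define f1 where "f1 t = e\<^sup>2 * pi * (S t * C t / (W t)\<^sup>2)" for t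
  define f2 where "f2 t = e\<^sup>2 * pi\<^sup>2 *
    (((C t)\<^sup>2 - (S t)\<^sup>2) * W t - 4 * (S t)\<^sup>2 * (C t)\<^sup>2) / (W t) ^ 3" for t
  have dS: "(S has_real_derivative pi * C t) (at t)" for t
    unfolding S_def C_def by (auto intro!: derivative_eq_intros)
  have dC: "(C has_real_derivative - pi * S t) (at t)" for t
    unfolding S_def C_def by (auto intro!: derivative_eq_intros)
  have dW: "(W has_real_derivative 2 * pi * (S t * C t)) (at t)" for t
    unfolding W_def by (auto intro!: derivative_eq_intros dS)
  have d1: "(f has_real_derivative f1 t) (at t)" for t
    unfolding f_def f1_def using Wpos[of t]
    by (auto intro!: derivative_eq_intros dW)
       (simp add: field_simps power2_eq_square)
  have d2: "(f1 has_real_derivative f2 t) (at t)" for t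
    unfolding f1_def f2_def using Wpos[of t]
    by (auto intro!: derivative_eq_intros dW dS dC)
       (simp add: field_simps power2_eq_square power3_eq_cube power4_eq_xxxx)
  have "continuous_on UNIV f2"
    unfolding f2_def using Wpos
    by (intro continuous_intros DERIV_continuous_on[OF dS] DERIV_continuous_on[OF dC]
        DERIV_continuous_on[OF dW]) (auto simp: less_le)
  moreover have "f s = f t" if "s - t \<in> \<int>" for s t
    using sin_pi_square_periodic[OF that, of q] by (simp add: f_def W_def S_def)
  ultimately obtain u where u: "u \<in> C2_circle" "\<And>t. u (to_circle t) = f t"
    "\<And>t. circle_deriv (circle_deriv u) (to_circle t) = f2 t"
    using C2_circle_lift[of f f1 f2] d1 d2 by metis
  have "1/2 \<le> f t" "f t \<le> 1" for t
    unfolding f_def using Wpos[of t] by (auto simp: W_def field_simps)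
  then have upos: "1/2 \<le> u x" and ule: "u x \<le> 1" for x
    using to_circle_rep[of x] u(2)[of "rep_circle x"] by metis+
  \<comment> \<open>With s = S^2 \<ge> e^2, the numerator of -u'' minus s is a sum of products of
    nonnegative factors. Keeping s gives the size of -u'' on the right interval and not only its
    sign.\<close>
  have concave: "e\<^sup>2 * pi\<^sup>2 * (S t)\<^sup>2 / (W t) ^ 3 \<le> - f2 t" if "e\<^sup>2 \<le> (S t)\<^sup>2" for t
  proof -
    define s where "s = (S t)\<^sup>2"
    have "0 \<le> s" "s \<le> 1" "e\<^sup>2 \<le> s" "0 \<le> e\<^sup>2"
      using that S2[of t] by (auto simp: s_def)
    then have "0 \<le> s * (1 - (s - e\<^sup>2)) + (s - e\<^sup>2) * (1 - s)"
      by (intro add_nonneg_nonneg mult_nonneg_nonneg) linarith+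
    also have "\<dots> = 4 * s * (1 - s) - (1 - 2 * s) * (e\<^sup>2 + s) - s"
      by (simp add: algebra_simps)
    finally have "s \<le> 4 * s * (1 - s) - (1 - 2 * s) * (e\<^sup>2 + s)" by simp
    then have "(S t)\<^sup>2 \<le> 4 * (S t)\<^sup>2 * (C t)\<^sup>2 - ((C t)\<^sup>2 - (S t)\<^sup>2) * W t"
      by (simp add: s_def C2 W_def)
    then have "e\<^sup>2 * pi\<^sup>2 * (S t)\<^sup>2 / (W t) ^ 3 \<le>
      e\<^sup>2 * pi\<^sup>2 * (4 * (S t)\<^sup>2 * (C t)\<^sup>2 - ((C t)\<^sup>2 - (S t)\<^sup>2) * W t) / (W t) ^ 3"
      using Wpos[of t] by (intro divide_right_mono mult_left_mono) auto
    also have "\<dots> = - f2 t"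
      unfolding f2_def minus_divide_left mult_minus_right[symmetric] by simp
    finally show ?thesis .
  qed
  \<comment> \<open>Here \<open>t - q\<close> runs through [r, 1 - r]; past the midpoint, reflecting
    the sine about pi/2 returns to its increasing branch.\<close>
  have sin_ge: "e \<le> S t" if "p \<le> t" "t \<le> p + 1 - 2 * r" for t
  proof (cases "t - q \<le> 1/2")
    case True
    have "pi * r \<le> pi * (t - q)" "pi * (t - q) \<le> pi * (1/2)"
      using that True by (intro mult_left_mono; simp add: q_def)+
    moreover have "0 \<le> pi * r" using r by simp
    ultimately show ?thesis
      unfolding S_def e_def using pi_half_gt_zero by (intro sin_monotone_2pi_le) linarith+
  next
    case False
    have "sin (pi * r) \<le> sin (pi - pi * (t - q))"
    proof (rule sin_monotone_2pi_le)
      have "pi * (r + (t - q)) \<le> pi * 1"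
        using that r by (intro mult_left_mono) (auto simp: q_def)
      then show "pi * r \<le> pi - pi * (t - q)" by (simp add: algebra_simps)
      have "pi * (1/2) \<le> pi * (t - q)" using False by (intro mult_left_mono) auto
      then show "pi - pi * (t - q) \<le> pi / 2" by simp
      have "0 \<le> pi * r" using r by simp
      then show "- (pi / 2) \<le> pi * r" by (smt (verit) pi_half_gt_zero)
    qed
    then show ?thesis by (simp add: S_def e_def)
  qed
  have "ereal (m / (125 * r\<^sup>2) * measure \<mu> (right_interval x0 r) - 0) \<le> I1 a \<mu>"
  proof (rule I1_lower_bound[OF a(1) \<mu> u(1)])
    fix x show "0 < u x" using upos[of x] by simp
  next
    have "left_interval x0 r0 \<in> sets \<mu>"
      using closed_left_interval \<mu>(2) by (auto intro: borel_closed)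
    then have "AE x in \<mu>. x \<notin> left_interval x0 r0"
      using r0 by (intro AE_not_in) (simp add: null_sets_def emeasure_eq_measure)
    then show "AE x in \<mu>. - 0 \<le> - (a x * (circle_deriv (circle_deriv u) x / u x))"
    proof eventually_elim
      case (elim x)
      obtain t where t: "x = to_circle t" "p \<le> t" "t < p + 1"
        by (rule to_circle_representative)
      \<comment> \<open>The lift \<open>t - 1\<close> lies below \<open>p\<close> and avoids
        \<open>{p - r0..p}\<close>, hence lies below \<open>p - 2 * r\<close>.\<close>
      have "to_circle (t - 1) = x" using t by (simp add: to_circle_eq_iff)
      then have "t - 1 \<notin> {p - r0..p}" using elim by (auto simp: p left_interval_to_circle)
      then have "t \<le> p + 1 - 2 * r" using t r by auto
      then have "e\<^sup>2 \<le> (S t)\<^sup>2"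
        using sin_ge[OF t(2)] \<open>0 < e\<close> by (intro power_mono) auto
      moreover have "0 \<le> e\<^sup>2 * pi\<^sup>2 * (S t)\<^sup>2 / (W t) ^ 3" using Wpos[of t] by simp
      ultimately have "f2 t \<le> 0" using concave[of t] by linarith
      then have "a x * (f2 t / u x) \<le> 0"
        using a(2)[of x] a(3) upos[of x]
        by (intro mult_nonneg_nonpos divide_nonpos_nonneg) auto
      then show ?case using u(3) t by simp
    qed
  next
    fix x assume "x \<in> right_interval x0 r"
    then obtain t where t: "x = to_circle t" "p \<le> t" "t \<le> p + r"
      by (auto simp: p right_interval_to_circle)
    have ge: "e \<le> S t" using t r by (intro sin_ge) auto
    \<comment> \<open>\<open>r \<le> 1/4\<close> keeps the argument on the increasing branch. The
      bound S \<le> 2 e gives W \<le> 5 e^2, and cubing produces 125.\<close>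
    have "S t \<le> sin (2 * (pi * r))"
      unfolding S_def
    proof (rule sin_monotone_2pi_le)
      have "0 \<le> pi * (t - q)" using t r by (simp add: q_def)
      then show "- (pi / 2) \<le> pi * (t - q)" using pi_half_gt_zero by linarith
      have "pi * (t - q) \<le> pi * (2 * r)" using t by (intro mult_left_mono) (auto simp: q_def)
      then show "pi * (t - q) \<le> 2 * (pi * r)" by simp
      have "pi * (2 * r) \<le> pi * (1/2)" using r by (intro mult_left_mono) auto
      then show "2 * (pi * r) \<le> pi / 2" by simp
    qed
    also have "\<dots> = 2 * e * cos (pi * r)" by (simp add: sin_double e_def)
    also have "\<dots> \<le> 2 * e * 1" using \<open>0 < e\<close> by (intro mult_left_mono) auto
    finally have "S t \<le> 2 * e" by simp
    have Sge: "e\<^sup>2 \<le> (S t)\<^sup>2" using ge \<open>0 < e\<close> by (intro power_mono) auto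
    have "(S t)\<^sup>2 \<le> (2 * e)\<^sup>2"
      using ge \<open>0 < e\<close> \<open>S t \<le> 2 * e\<close> by (intro power_mono) auto
    then have "W t \<le> 5 * e\<^sup>2" by (simp add: W_def power_mult_distrib)
    then have W3: "(W t) ^ 3 \<le> (5 * e\<^sup>2) ^ 3" using Wpos[of t] by (intro power_mono) auto
    have "1 / (125 * r\<^sup>2) = pi\<^sup>2 / (125 * (pi * r)\<^sup>2)"
      by (simp add: power_mult_distrib)
    also have "\<dots> \<le> pi\<^sup>2 / (125 * e\<^sup>2)"
      using e_le \<open>0 < e\<close> by (intro divide_left_mono mult_left_mono power_mono mult_pos_pos) auto
    also have "\<dots> = e\<^sup>2 * pi\<^sup>2 * e\<^sup>2 / (5 * e\<^sup>2) ^ 3"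
      using \<open>0 < e\<close> by (simp add: field_simps power2_eq_square power3_eq_cube)
    also have "\<dots> \<le> e\<^sup>2 * pi\<^sup>2 * (S t)\<^sup>2 / (W t) ^ 3"
      using W3 Sge Wpos[of t] by (intro frac_le mult_left_mono) auto
    also have "\<dots> \<le> - f2 t" by (rule concave[OF Sge])
    finally have f2: "1 / (125 * r\<^sup>2) \<le> - f2 t" .
    have "0 \<le> 1 / (125 * r\<^sup>2)" by simp
    then have "f2 t \<le> 0" using f2 by linarith
    have "m / (125 * r\<^sup>2) = m * (1 / (125 * r\<^sup>2) / 1)" by simp
    also have "\<dots> \<le> a x * (- f2 t / u x)"
      using f2 \<open>f2 t \<le> 0\<close> a(2)[of x] a(3) upos[of x] ule[of x] r
      by (intro mult_mono frac_le) auto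
    finally show "m / (125 * r\<^sup>2) \<le> - (a x * (circle_deriv (circle_deriv u) x / u x))"
      using u(3) t by simp
  qed (use a r in auto)
  then show ?thesis by simp
qed

section \<open>From power bounds to local dimensions\<close>

text \<open>Take logarithms: dividing ln F \<le> ln M + k ln r by the negative ln r reverses it, and
  ln M / ln r tends to 0.\<close>

lemma Liminf_local_dim_ge:
  fixes F :: "real \<Rightarrow> real"
  assumes mono: "\<And>r s. r \<le> s \<Longrightarrow> F r \<le> F s" and nonneg: "\<And>r. 0 \<le> F r"
    and pos: "\<not> (\<forall>\<^sub>F r in at_right 0. F r = 0)"
    and bound: "\<forall>\<^sub>F r in at_right 0. F r \<le> M * r ^ k"
  shows "ereal (real k) \<le> Liminf (at_right 0) (\<lambda>r. ereal (ln (F r) / ln r))"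
proof -
  \<comment> \<open>By monotonicity a zero would persist at all smaller radii; positivity keeps
    \<open>ln\<close> away from 0.\<close>
  have Fpos: "0 < F s" if "0 < s" for s
  proof (rule ccontr)
    assume "\<not> 0 < F s"
    then have "F r = 0" if "r \<le> s" for r
      using mono[OF that] nonneg[of r] by linarith
    then have "\<forall>\<^sub>F r in at_right 0. F r = 0"
      using that by (intro eventually_mono[OF eventually_at_right_real[of 0 s]]) auto
    then show False using pos by simp
  qed
  have "\<forall>\<^sub>F r in at_right (0::real). r < 1"
    by (rule eventually_at_right_real[of 0 1, THEN eventually_mono]) auto
  with bound eventually_at_right_less[of 0]
  have "\<forall>\<^sub>F r in at_right 0. ereal (real k + ln M / ln r) \<le> ereal (ln (F r) / ln r)"
  proof eventually_elim
    case (elim r)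
    have "0 < M * r ^ k" using Fpos[of r] elim by linarith
    then have "0 < M" using elim by (simp add: zero_less_mult_iff)
    have "ln (F r) \<le> ln (M * r ^ k)" using elim Fpos[of r] by simp
    also have "\<dots> = ln M + real k * ln r" using \<open>0 < M\<close> elim by (simp add: ln_mult ln_realpow)
    finally have "(ln M + real k * ln r) / ln r \<le> ln (F r) / ln r"
      using elim by (intro divide_right_mono_neg) auto
    then show ?case using elim by (simp add: add_divide_distrib add.commute)
  qed
  then have "Liminf (at_right 0) (\<lambda>r. ereal (real k + ln M / ln r)) \<le>
      Liminf (at_right 0) (\<lambda>r. ereal (ln (F r) / ln r))"
    by (rule Liminf_mono)
  moreover have "((\<lambda>r. real k + ln M / ln r) \<longlongrightarrow> real k + 0) (at_right 0)"
    by (intro tendsto_intros real_tendsto_divide_at_top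
          tendsto_divide_0[OF tendsto_const] filterlim_at_bot_imp_at_infinity ln_at_0)
  then have "Liminf (at_right 0) (\<lambda>r. ereal (real k + ln M / ln r)) = ereal (real k)"
    by (intro lim_imp_Liminf) auto
  ultimately show ?thesis by simp
qed

theorem corollary2p11:
  fixes a :: "circle \<Rightarrow> real" and \<mu> :: "circle measure" and I :: "circle set"
    and x0 :: circle and \<alpha>l \<alpha>r :: ereal
  assumes "a \<in> C2_circle" and "\<forall>x. a x > 0"
    and "prob_space \<mu>" and "sets \<mu> = sets borel"
    and "nonempty_open_interval I" and "measure \<mu> I = 0"
    and "\<alpha>l = lower_left_local_dim \<mu> x0" and "\<alpha>r = upper_right_local_dim \<mu> x0"
    and "(- \<infinity> < \<alpha>l \<and> \<alpha>l < \<alpha>r \<and> \<alpha>l < 1) \<or>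
         (- \<infinity> < \<alpha>l \<and> \<alpha>l = \<alpha>r \<and> \<alpha>r < 1) \<or>
         (- \<infinity> = \<alpha>l \<and> \<alpha>l < \<alpha>r \<and> \<alpha>r \<le> 1)"
  shows "I1 a \<mu> = \<infinity>"
proof (rule ccontr)
  interpret prob_space \<mu> by fact
  assume inf: "I1 a \<mu> \<noteq> \<infinity>"
  have "continuous_on UNIV (\<lambda>t. a (to_circle t))"
    using assms(1) by (rule C2_circle_imp_continuous)
  then obtain y z where yz: "\<And>x. a y \<le> a x" "\<And>x. a x \<le> a z"
    using circle_continuous_range by blast
  define m where "m = a y"
  have m: "0 < m" "\<And>x. m \<le> a x" using yz assms(2) by (auto simp: m_def)
  \<comment> \<open>One \<open>C\<close> serves all radii, which turns the test-function estimates
    into power bounds.\<close>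
  obtain C where C: "I1 a \<mu> \<le> ereal C"
    using inf by (cases "I1 a \<mu>") auto
  let ?l = "\<lambda>r. measure \<mu> (left_interval x0 r)"
  let ?r = "\<lambda>r. measure \<mu> (right_interval x0 r)"
  have sets: "left_interval x0 r \<in> sets \<mu>" "right_interval x0 r \<in> sets \<mu>" for r
    using assms(4) closed_left_interval closed_right_interval by (auto intro: borel_closed)
  have lmono: "?l r \<le> ?l s" if "r \<le> s" for r s
    using that sets by (intro finite_measure_mono) (auto simp: left_interval_def)
  have rmono: "?r r \<le> ?r s" if "r \<le> s" for r s
    using that sets by (intro finite_measure_mono) (auto simp: right_interval_def)
  have left: "1 \<le> \<alpha>l" if "\<not> (\<forall>\<^sub>F r in at_right 0. ?l r = 0)"
  proof -
    have "\<forall>\<^sub>F r in at_right 0. ?l r \<le> (48 * (C + 16 * a z) / m) * r ^ 1"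
    proof -
      have "?l r \<le> (48 * (C + 16 * a z) / m) * r ^ 1" if r: "0 < r" "r < 1/10" for r
      proof -
        have "ereal (m / (48 * r) * ?l r - 16 * a z) \<le> I1 a \<mu>"
          using m yz r by (intro left_interval_bound assms(1,3,4)) auto
        from this C have "ereal (m / (48 * r) * ?l r - 16 * a z) \<le> ereal C" by (rule order_trans)
        then show ?thesis using r m by (simp add: field_simps)
      qed
      then show ?thesis
        by (intro eventually_mono[OF eventually_at_right_real[of 0 "1/10"]]) auto
    qed
    from Liminf_local_dim_ge[OF lmono _ that this] show ?thesis
      using that assms(7) by (simp add: lower_left_local_dim_def one_ereal_def)
  qed
  have right: "2 \<le> \<alpha>r"
    if l0: "\<forall>\<^sub>F r in at_right 0. ?l r = 0" and "\<not> (\<forall>\<^sub>F r in at_right 0. ?r r = 0)"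
  proof -
    obtain b where b: "0 < b" "\<And>r. 0 < r \<Longrightarrow> r < b \<Longrightarrow> ?l r = 0"
      using l0 by (auto simp: eventually_at_right_field)
    \<comment> \<open>Halving keeps \<open>r0\<close> strictly below \<open>b\<close>; the cap 1/2
      makes \<open>r < r0 / 2\<close> imply \<open>r \<le> 1/4\<close>.\<close>
    define r0 where "r0 = min (b / 2) (1/2)"
    have r0: "0 < r0" "r0 < 1" "?l r0 = 0" using b by (auto simp: r0_def intro!: b(2))
    have "\<forall>\<^sub>F r in at_right 0. ?r r \<le> (125 * C / m) * r ^ 2"
    proof -
      have "?r r \<le> (125 * C / m) * r ^ 2" if r: "0 < r" "r < r0 / 2" for r
      proof -
        have "ereal (m / (125 * r\<^sup>2) * ?r r) \<le> I1 a \<mu>"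
          using m r r0 by (intro right_interval_bound[of a m \<mu> x0 r0] assms(1,3,4)) (auto simp: r0_def)
        from this C have "ereal (m / (125 * r\<^sup>2) * ?r r) \<le> ereal C" by (rule order_trans)
        then show ?thesis using r m by (simp add: field_simps)
      qed
      then show ?thesis
        using r0 by (intro eventually_mono[OF eventually_at_right_real[of 0 "r0 / 2"]]) auto
    qed
    from Liminf_local_dim_ge[OF rmono _ that(2) this]
    have "2 \<le> Liminf (at_right 0) (\<lambda>r. ereal (ln (?r r) / ln r))" by simp
    \<comment> \<open>The power bound holds at all small radii, so it controls even the lower
      limit.\<close>
    also have "\<dots> \<le> Limsup (at_right 0) (\<lambda>r. ereal (ln (?r r) / ln r))"
      by (intro Liminf_le_Limsup) simp
    finally show ?thesis using that(2) assms(8) by (simp add: upper_right_local_dim_def)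
  qed
  show False
  \<comment> \<open>If the left mass vanishes at small radii, only the third alternative remains:
    there \<open>\<alpha>r > - \<infinity>\<close> makes the right estimate applicable, against
    \<open>\<alpha>r \<le> 1\<close>. Otherwise \<open>\<alpha>l \<ge> 1\<close> excludes all
    three.\<close>
  proof (cases "\<forall>\<^sub>F r in at_right 0. ?l r = 0")
    case True
    then have "\<alpha>l = - \<infinity>" using assms(7) by (simp add: lower_left_local_dim_def)
    then have r: "- \<infinity> < \<alpha>r" "\<alpha>r \<le> 1" using assms(9) by auto
    then have "\<not> (\<forall>\<^sub>F r in at_right 0. ?r r = 0)"
      using assms(8) by (auto simp: upper_right_local_dim_def)
    from right[OF True this] r(2) have "(2::ereal) \<le> 1" by (rule order_trans)
    then show False by simp
  next
    case False
    from left[OF this] assms(9) show False by auto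
  qed
qed

end
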